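(* Any end of a properly immersed self-translating $n$-dimensional hypersurface $\Sigma$ in $\mathbb{R}^{n+1}$ cannot be contained in two transverse vertical halfspaces of $\mathbb{R}^{n+1}$.
   Context: A self-translating hypersurface $\Sigma^n\subseteq\mathbb{R}^{n+1}$ (with velocity $e_{n+1}$) is a smooth immersed hypersurface satisfying $\boldsymbol{H}=\langle e_{n+1},\nu\rangle\,\nu$, where $\boldsymbol{H}$ is the mean curvature vector (the trace of the vector-valued second fundamental form $A(X,Y)=(\nabla^{\mathbb{R}^{n+1}}_XY)^\perp$), $\nu$ is a unit normal, and $e_{n+1}$ is the last standard basis vector of $\mathbb{R}^{n+1}$. "Contained in two halfspaces" means that the image under the immersion lies in both halfspaces, i.e. in their intersection. An end of $\Sigma$ means a connected component of $\Sigma\setminus K$ with noncompact closure in $\Sigma$, where $K\subseteq\Sigma$ is a compact subset. An (affine) halfspace is $H_{(b,w)}=\{x\in\mathbb{R}^{n+1}:\langle x-b,w\rangle\ge 0\}$ with $b\in\mathbb{R}^{n+1}$ and $w\in\mathbb{S}^n$ a unit vector. It is vertical if $w\perp e_{n+1}$. Two halfspaces $H_{(b_1,w_1)},H_{(b_2,w_2)}$ are transverse if $w_1$ and $w_2$ are neither parallel nor antiparallel, i.e. $w_1\neq\pm w_2$. *)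

theory Defs
  imports "HOL-Analysis.Analysis"
begin

section \<open>Smooth maps on open subsets of Euclidean space\<close>

fun times_differentiable_on ::
    "nat \<Rightarrow> ('a::euclidean_space \<Rightarrow> 'b::real_normed_vector) \<Rightarrow> 'a set \<Rightarrow> bool" where
  "times_differentiable_on 0 f V \<longleftrightarrow> continuous_on V f"
| "times_differentiable_on (Suc k) f V \<longleftrightarrow>
     (\<forall>x\<in>V. f differentiable (at x)) \<and>
     (\<forall>v. times_differentiable_on k (\<lambda>x. frechet_derivative f (at x) v) V)"

text \<open>Derivatives are taken at full neighbourhoods, so this is only meant for open \<open>V\<close>.\<close>

definition smooth_on ::
    "('a::euclidean_space \<Rightarrow> 'b::real_normed_vector) \<Rightarrow> 'a set \<Rightarrow> bool" where
  "smooth_on f V \<longleftrightarrow> (\<forall>k. times_differentiable_on k f V)"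


section \<open>Smooth manifolds\<close>

text \<open>
  A smooth structure is given by an atlas of local parametrizations (inverse charts)
  \<open>(V, \<psi>)\<close>, where \<open>\<psi>\<close> maps the open set \<open>V\<close> of \<open>\<real>\<^sup>n\<close> homeomorphically onto an open subset
  of \<open>X\<close>. The atlas need not be maximal. The manifold has no boundary and need not be connected.
\<close>

definition parametrization ::
    "'a topology \<Rightarrow> (real^'n) set \<Rightarrow> (real^'n \<Rightarrow> 'a) \<Rightarrow> bool" where
  "parametrization X V \<psi> \<longleftrightarrow>
     open V \<and> openin X (\<psi> ` V) \<and> embedding_map (top_of_set V) X \<psi>"

definition smooth_atlas ::
    "'a topology \<Rightarrow> ((real^'n) set \<times> (real^'n \<Rightarrow> 'a)) set \<Rightarrow> bool" where
  "smooth_atlas X \<A> \<longleftrightarrow>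
     (\<forall>(V, \<psi>)\<in>\<A>. parametrization X V \<psi>) \<and>
     (\<Union>(V, \<psi>)\<in>\<A>. \<psi> ` V) = topspace X \<and>
     (\<forall>(V, \<psi>)\<in>\<A>. \<forall>(V', \<psi>')\<in>\<A>.
        smooth_on (inv_into V' \<psi>' \<circ> \<psi>) {x \<in> V. \<psi> x \<in> \<psi>' ` V'})"

definition smooth_manifold ::
    "'a topology \<Rightarrow> ((real^'n) set \<times> (real^'n \<Rightarrow> 'a)) set \<Rightarrow> bool" where
  "smooth_manifold X \<A> \<longleftrightarrow> Hausdorff_space X \<and> second_countable X \<and> smooth_atlas X \<A>"


section \<open>Immersed hypersurfaces\<close>

text \<open>
  The ambient space \<open>\<real>\<^sup>n\<^sup>+\<^sup>1\<close> is the Euclidean space \<open>\<real>\<^sup>n \<times> \<real>\<close>; its last standard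
  basis vector is \<open>(0, 1)\<close>.
\<close>

type_synonym 'n ambient = "(real^'n) \<times> real"

definition e_last :: "'n::finite ambient" where
  "e_last = (0, 1)"

definition smooth_immersion ::
    "((real^'n) set \<times> (real^'n \<Rightarrow> 'a)) set \<Rightarrow> ('a \<Rightarrow> 'n ambient) \<Rightarrow> bool" where
  "smooth_immersion \<A> F \<longleftrightarrow>
     (\<forall>(V, \<psi>)\<in>\<A>. smooth_on (F \<circ> \<psi>) V \<and>
        (\<forall>x\<in>V. inj (frechet_derivative (F \<circ> \<psi>) (at x))))"


section \<open>Mean curvature\<close>

text \<open>
  In this section \<open>f\<close> is an immersion of an open subset of \<open>\<real>\<^sup>n\<close>, i.e. the immersion
  of the hypersurface read in a local parametrization.
\<close>

definition tangent_plane :: "(real^'n \<Rightarrow> 'n ambient) \<Rightarrow> real^'n \<Rightarrow> 'n ambient set" where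
  "tangent_plane f x = range (frechet_derivative f (at x))"

definition unit_normal :: "(real^'n \<Rightarrow> 'n ambient) \<Rightarrow> real^'n \<Rightarrow> 'n ambient \<Rightarrow> bool" where
  "unit_normal f x \<nu> \<longleftrightarrow> norm \<nu> = 1 \<and> (\<forall>t\<in>tangent_plane f x. orthogonal t \<nu>)"

definition normal_component :: "'b::euclidean_space set \<Rightarrow> 'b \<Rightarrow> 'b" where
  "normal_component T w = (THE p. (\<forall>t\<in>T. orthogonal t p) \<and> w - p \<in> T)"

lemma normal_component_eqI:
  assumes "subspace T" "\<And>t. t \<in> T \<Longrightarrow> orthogonal t p" "w - p \<in> T"
  shows "normal_component T w = p"
  unfolding normal_component_def
proof (rule the_equality)
  fix q assume q: "(\<forall>t\<in>T. orthogonal t q) \<and> w - q \<in> T"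
  have "(w - p) - (w - q) \<in> T"
    using assms(1,3) q by (blast intro: subspace_diff)
  then have "q - p \<in> T" by simp
  then have "orthogonal (q - p) (q - p)"
    using assms(2) q by (blast intro: orthogonal_clauses)
  then show "q = p" by (simp add: orthogonal_self)
qed (use assms in blast)

text \<open>
  The second fundamental form \<open>A(X, Y)\<close>, the normal part of the ambient derivative of \<open>Y\<close>
  along \<open>X\<close>, for the tangent fields \<open>X = df(u)\<close> and \<open>Y = df(v)\<close> with constant
  \<open>u\<close>, \<open>v\<close>. As \<open>A\<close> is tensorial, these fields determine it.
\<close>

definition second_fundamental_form ::
    "(real^'n \<Rightarrow> 'n ambient) \<Rightarrow> real^'n \<Rightarrow> real^'n \<Rightarrow> real^'n \<Rightarrow> 'n ambient" where
  "second_fundamental_form f x u v =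
     normal_component (tangent_plane f x)
       (frechet_derivative (\<lambda>y. frechet_derivative f (at y) v) (at x) u)"

definition metric_matrix :: "(real^'n \<Rightarrow> 'n ambient) \<Rightarrow> real^'n \<Rightarrow> real^'n^'n" where
  "metric_matrix f x =
     (\<chi> i j. frechet_derivative f (at x) (axis i 1) \<bullet> frechet_derivative f (at x) (axis j 1))"

text \<open>The trace of \<open>A\<close> with respect to the induced metric: the sum of \<open>g\<^sup>i\<^sup>j A(\<partial>\<^sub>i, \<partial>\<^sub>j)\<close>.\<close>

definition mean_curvature_vector :: "(real^'n \<Rightarrow> 'n ambient) \<Rightarrow> real^'n \<Rightarrow> 'n ambient" where
  "mean_curvature_vector f x =
     (\<Sum>i\<in>UNIV. \<Sum>j\<in>UNIV. matrix_inv (metric_matrix f x) $ i $ j *\<^sub>R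
        second_fundamental_form f x (axis i 1) (axis j 1))"


section \<open>Self-translating hypersurfaces, ends and halfspaces\<close>

text \<open>
  The equation is invariant under \<open>\<nu> \<mapsto> -\<nu>\<close>, so it is required for both unit normals at each
  point and no orientability is assumed.
\<close>

definition self_translating_hypersurface ::
    "'a topology \<Rightarrow> ((real^'n) set \<times> (real^'n \<Rightarrow> 'a)) set \<Rightarrow> ('a \<Rightarrow> 'n ambient) \<Rightarrow> bool" where
  "self_translating_hypersurface X \<A> F \<longleftrightarrow>
     smooth_manifold X \<A> \<and> smooth_immersion \<A> F \<and>
     (\<forall>(V, \<psi>)\<in>\<A>. \<forall>x\<in>V. \<forall>\<nu>. unit_normal (F \<circ> \<psi>) x \<nu> \<longrightarrow>
        mean_curvature_vector (F \<circ> \<psi>) x = (e_last \<bullet> \<nu>) *\<^sub>R \<nu>)"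

definition end_of :: "'a topology \<Rightarrow> 'a set \<Rightarrow> bool" where
  "end_of X E \<longleftrightarrow>
     (\<exists>K. compactin X K \<and>
          E \<in> connected_components_of (subtopology X (topspace X - K)) \<and>
          \<not> compactin X (X closure_of E))"

definition halfspace :: "'b::euclidean_space \<Rightarrow> 'b \<Rightarrow> 'b set" where
  "halfspace b w = {x. (x - b) \<bullet> w \<ge> 0}"

end

theory Submission
  imports Defs
begin

text \<open>
  Write \<open>z\<close> for the height \<open>x \<bullet> e_last\<close> and \<open>n\<close> for \<open>CARD('n)\<close>. On a self-translating
  hypersurface the natural operator is the drift Laplacian, which takes an ambient function
  \<open>f\<close> to \<open>L f = tr D\<^sup>2 f - D\<^sup>2 f(\<nu>, \<nu>) + \<partial>f/\<partial>z\<close> at every critical point of the restricted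
  function: the trace over the tangent hyperplane comes from the second derivatives of \<open>f\<close>, and
  the last term comes from the translator equation, because the gradient of \<open>f\<close> is normal there
  and pairs with the mean curvature vector as it does with \<open>e_last\<close>. Hence \<open>f\<close> has no local
  maximum on the hypersurface at a point where \<open>L f > 0\<close> for every unit vector \<open>\<nu>\<close>
  (lemma \<open>drift_laplacian_nonpos_at_local_max\<close>). This is the only fact about translators that
  is used, and it is recorded as the predicate \<open>weak_translator\<close> on subsets of the ambient
  space.

  Let \<open>M\<close> be the image of the end \<open>E\<close> and \<open>C\<close> the image of the compact set \<open>K\<close> that was
  removed. As the immersion is proper, \<open>M \<union> C\<close> is closed, and \<open>M\<close> is unbounded because the
  closure of \<open>E\<close> is not compact. Two explicit test functions show that \<open>M\<close> is nevertheless
  bounded if it lies in the wedge.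

  First, the height is bounded above on \<open>M\<close> (lemma \<open>wedge_height_bounded\<close>). Let
  \<open>l\<^sub>1, l\<^sub>2 \<ge> 0\<close> be the two linear functions that define the wedge, and let \<open>A\<close> be large. The
  function \<open>1/2 (l\<^sub>1\<^sup>2 + l\<^sub>2\<^sup>2) - A (l\<^sub>1 + l\<^sub>2)\<close> is half the squared distance, in the
  \<open>(l\<^sub>1, l\<^sub>2)\<close> plane, from the point \<open>(A, A)\<close> far inside the wedge, up to a constant. Near the
  vertex of the wedge, on the side \<open>l\<^sub>1 + l\<^sub>2 \<le> A\<close>, it is bounded above; it is much smaller
  on the segment \<open>l\<^sub>1 + l\<^sub>2 = A\<close> than at any fixed point; and \<open>L\<close> of it is at least
  \<open>1 - \<bar>w\<^sub>1 \<bullet> w\<^sub>2\<bar>\<close>, which is positive by transversality. The term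
  \<open>- A\<^sup>2/2 exp (c - z)\<close> has \<open>L \<ge> 0\<close>; it makes the test function equally small at the level
  \<open>z = c\<close> above \<open>C\<close> but has decayed by the level \<open>c + 1\<close>. So a point of \<open>M\<close> above
  \<open>c + 1\<close> would force an interior maximum.

  Second, a set whose height is bounded above is bounded altogether (lemma
  \<open>weak_translator_bounded\<close>). With \<open>r\<close> the distance from the vertical axis and \<open>z \<le> c\<close> on
  \<open>M\<close>, the function \<open>v = c - z + r\<^sup>2\<close> satisfies \<open>L v \<ge> 1\<close> as soon as \<open>n \<ge> 2\<close>, whereas the
  square of \<open>u = c - z + r\<^sup>2 / (16 n)\<close> grows faster than \<open>v\<close> and has \<open>L (u\<^sup>2) \<le> 2\<close>.
  Therefore \<open>v - \<epsilon> u\<^sup>2\<close> has no maximum on \<open>M\<close> for small \<open>\<epsilon>\<close>; it is bounded by the maximum of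
  \<open>v\<close> over \<open>C\<close>, and \<open>\<epsilon> \<rightarrow> 0\<close> bounds \<open>v\<close> itself. Two transverse vertical halfspaces exist
  only if \<open>n \<ge> 2\<close>; for \<open>n = 1\<close> the grim reaper lies in a slab.
\<close>


section \<open>Traces and orthonormal bases\<close>

lemma orthonormal_expansion:
  fixes B :: "'b::euclidean_space set"
  assumes "finite B" and orth: "pairwise orthogonal B" and unit: "\<And>b. b \<in> B \<Longrightarrow> norm b = 1"
    and y: "y \<in> span B"
  shows "(\<Sum>b\<in>B. (b \<bullet> y) *\<^sub>R b) = y"
proof -
  obtain u where u: "y = (\<Sum>b\<in>B. u b *\<^sub>R b)"
    using y span_finite[OF \<open>finite B\<close>] by auto
  have "b \<bullet> y = u b" if "b \<in> B" for b
  proof -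
    have "b \<bullet> y = (\<Sum>c\<in>B. u c * (b \<bullet> c))"
      by (simp add: u inner_sum_right)
    also have "\<dots> = (\<Sum>c\<in>B. if c = b then u b else 0)"
      using orth unit that by (intro sum.cong refl) (auto simp: pairwise_def orthogonal_def norm_eq_1)
    finally show ?thesis
      using \<open>finite B\<close> that by simp
  qed
  then show ?thesis
    by (simp add: u)
qed

lemma trace_orthonormal_basis:
  fixes B :: "'b::euclidean_space set" and h :: "'b \<Rightarrow> 'b"
  assumes "finite B" "pairwise orthogonal B" "\<And>b. b \<in> B \<Longrightarrow> norm b = 1" "span B = UNIV" and "linear h"
  shows "(\<Sum>b\<in>B. b \<bullet> h b) = (\<Sum>b\<in>Basis. b \<bullet> h b)"
proof -
  have "(\<Sum>b\<in>Basis. b \<bullet> h b) = (\<Sum>b\<in>Basis. \<Sum>c\<in>B. (c \<bullet> b) * (c \<bullet> h b))"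
  proof (rule sum.cong[OF refl])
    fix b :: 'b
    have "b \<bullet> h b = (\<Sum>c\<in>B. (c \<bullet> b) *\<^sub>R c) \<bullet> h b"
      by (simp add: orthonormal_expansion[OF assms(1-3)] assms(4))
    then show "b \<bullet> h b = (\<Sum>c\<in>B. (c \<bullet> b) * (c \<bullet> h b))"
      by (simp add: inner_sum_left)
  qed
  also have "\<dots> = (\<Sum>c\<in>B. c \<bullet> h (\<Sum>b\<in>Basis. (c \<bullet> b) *\<^sub>R b))"
    by (subst sum.swap) (simp add: linear_sum[OF assms(5)] linear_cmul[OF assms(5)] inner_sum_right)
  finally show ?thesis
    by (simp add: euclidean_representation)
qed

lemma trace_rank_one: "(\<Sum>b\<in>Basis. b \<bullet> ((b \<bullet> w) *\<^sub>R w)) = (norm w)\<^sup>2"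
  for w :: "'b::euclidean_space"
proof -
  have "(norm w)\<^sup>2 = (\<Sum>b\<in>Basis. (w \<bullet> b) * (w \<bullet> b))"
    by (simp only: power2_norm_eq_inner euclidean_inner[symmetric])
  then show ?thesis
    by (simp add: inner_commute mult.commute)
qed

lemma matrix_inv_eqI:
  fixes A B :: "'a::field^'n^'n"
  assumes "B ** A = mat 1"
  shows "matrix_inv A = B"
  unfolding matrix_inv_def
proof (rule some_equality)
  show "A ** B = mat 1 \<and> B ** A = mat 1"
    using assms matrix_left_right_inverse by blast
next
  fix C assume "A ** C = mat 1 \<and> C ** A = mat 1"
  then show "C = B"
    using assms by (metis matrix_mul_assoc matrix_mul_lid matrix_mul_rid)
qed

text \<open>
  The left side is the quadratic form of \<open>w\<^sub>1 w\<^sub>1\<^sup>T + w\<^sub>2 w\<^sub>2\<^sup>T\<close> at \<open>\<nu>\<close>, and the largest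
  eigenvalue of this matrix is \<open>1 + \<bar>w\<^sub>1 \<bullet> w\<^sub>2\<bar>\<close>. As its trace is \<open>2\<close>, its trace over any
  hyperplane is at least \<open>1 - \<bar>w\<^sub>1 \<bullet> w\<^sub>2\<bar>\<close>.
\<close>

lemma sum_squares_inner_unit:
  fixes \<nu> w\<^sub>1 w\<^sub>2 :: "'b::euclidean_space"
  assumes "norm \<nu> = 1" "norm w\<^sub>1 = 1" "norm w\<^sub>2 = 1"
  shows "(\<nu> \<bullet> w\<^sub>1)\<^sup>2 + (\<nu> \<bullet> w\<^sub>2)\<^sup>2 \<le> 1 + \<bar>w\<^sub>1 \<bullet> w\<^sub>2\<bar>"
proof -
  define \<alpha> \<beta> q where "\<alpha> = \<nu> \<bullet> w\<^sub>1" and "\<beta> = \<nu> \<bullet> w\<^sub>2" and "q = \<alpha> *\<^sub>R w\<^sub>1 + \<beta> *\<^sub>R w\<^sub>2"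
  define s where "s = \<alpha>\<^sup>2 + \<beta>\<^sup>2"
  have w: "w\<^sub>1 \<bullet> w\<^sub>1 = 1" "w\<^sub>2 \<bullet> w\<^sub>2 = 1"
    using assms by (simp_all add: norm_eq_1)
  have "s = \<nu> \<bullet> q"
    by (simp add: s_def q_def \<alpha>_def \<beta>_def inner_add_right power2_eq_square)
  also have "\<dots> \<le> norm q"
    using norm_cauchy_schwarz[of \<nu> q] assms by simp
  finally have "s\<^sup>2 \<le> (norm q)\<^sup>2"
    by (simp add: s_def)
  also have "\<dots> = s + 2 * \<alpha> * \<beta> * (w\<^sub>1 \<bullet> w\<^sub>2)"
    unfolding power2_norm_eq_inner q_def s_def
    by (simp add: inner_add_left inner_add_right w inner_commute[of w\<^sub>2 w\<^sub>1]
        algebra_simps power2_eq_square)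
  also have "2 * \<alpha> * \<beta> * (w\<^sub>1 \<bullet> w\<^sub>2) \<le> \<bar>2 * \<alpha> * \<beta>\<bar> * \<bar>w\<^sub>1 \<bullet> w\<^sub>2\<bar>"
    by (metis abs_ge_self abs_mult)
  also have "\<dots> \<le> s * \<bar>w\<^sub>1 \<bullet> w\<^sub>2\<bar>"
  proof (rule mult_right_mono)
    show "\<bar>2 * \<alpha> * \<beta>\<bar> \<le> s"
      using sum_squares_bound[of \<alpha> \<beta>] sum_squares_bound[of "-\<alpha>" \<beta>] by (auto simp: s_def abs_if)
  qed simp
  finally have "s * s \<le> s * (1 + \<bar>w\<^sub>1 \<bullet> w\<^sub>2\<bar>)"
    by (simp add: power2_eq_square algebra_simps)
  moreover have "s \<ge> 0"
    by (simp add: s_def)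
  ultimately show ?thesis
    unfolding s_def[symmetric, unfolded \<alpha>_def \<beta>_def]
    by (metis abs_ge_zero add_nonneg_nonneg mult_le_cancel_left_pos order_le_less zero_le_one)
qed

section \<open>Vertical and horizontal directions\<close>

lemma e_last_unit [simp]: "e_last \<bullet> e_last = 1" "norm e_last = 1"
  by (simp_all add: e_last_def)

definition horizontal_part :: "'n::finite ambient \<Rightarrow> 'n ambient" where
  "horizontal_part x = x - (x \<bullet> e_last) *\<^sub>R e_last"

lemma inner_horizontal_part:
  "horizontal_part x \<bullet> y = x \<bullet> horizontal_part y" "horizontal_part (horizontal_part x) = horizontal_part x"
  "horizontal_part x \<bullet> e_last = 0" "e_last \<bullet> horizontal_part x = 0"
  "horizontal_part e_last = 0"
  by (simp_all add: horizontal_part_def inner_diff_left inner_diff_right inner_commute algebra_simps)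

lemma norm_horizontal_part: "(norm (horizontal_part x))\<^sup>2 = x \<bullet> horizontal_part x"
  by (simp add: power2_norm_eq_inner inner_horizontal_part)

lemma bounded_linear_horizontal_part: "bounded_linear horizontal_part"
  unfolding horizontal_part_def
  by (intro bounded_linear_sub bounded_linear_ident bounded_linear_scaleR_const bounded_linear_inner_left)

lemma horizontal_part_unit_bounds:
  assumes "norm \<nu> = 1" shows "0 \<le> \<nu> \<bullet> horizontal_part \<nu>" "\<nu> \<bullet> horizontal_part \<nu> \<le> 1"
proof -
  show "0 \<le> \<nu> \<bullet> horizontal_part \<nu>" by (metis norm_horizontal_part zero_le_power2)
  show "\<nu> \<bullet> horizontal_part \<nu> \<le> 1"
    using assms by (simp add: horizontal_part_def inner_diff_right norm_eq_1)
qed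

lemma trace_horizontal_part: "(\<Sum>b\<in>(Basis :: 'n::finite ambient set). b \<bullet> horizontal_part b) = real CARD('n)"
  using trace_rank_one[of "e_last :: 'n ambient"]
  by (simp add: horizontal_part_def inner_diff_right sum_subtractf inner_same_Basis)

lemma bounded_cylinder:
  fixes M :: "'n::finite ambient set"
  assumes "\<And>x. x \<in> M \<Longrightarrow> (norm (horizontal_part x))\<^sup>2 \<le> r" "\<And>x. x \<in> M \<Longrightarrow> \<bar>x \<bullet> e_last\<bar> \<le> s"
  shows "bounded M"
proof (rule boundedI)
  fix x assume x: "x \<in> M"
  have "norm x \<le> norm (horizontal_part x) + \<bar>x \<bullet> e_last\<bar>"
    using norm_triangle_ineq[of "horizontal_part x" "(x \<bullet> e_last) *\<^sub>R e_last"] by (simp add: horizontal_part_def)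
  also have "\<dots> \<le> sqrt r + s"
    using assms[OF x] by (intro add_mono) (auto intro: real_le_rsqrt)
  finally show "norm x \<le> sqrt r + s" .
qed

section \<open>The second derivative test on a translator\<close>

text \<open>
  Existence of the orthogonal decomposition makes \<open>normal_component\<close> meaningful; pairing it
  with a normal vector then does not see the tangential part.
\<close>

lemma inner_normal_component:
  assumes "subspace T" and "\<And>t. t \<in> T \<Longrightarrow> orthogonal t v"
  shows "v \<bullet> normal_component T w = v \<bullet> w"
proof -
  have span: "span T = T"
    using assms(1) by (simp only: span_eq_iff)
  obtain t p where t: "t \<in> T" "\<And>s. s \<in> T \<Longrightarrow> orthogonal p s" "w = t + p"
    using orthogonal_subspace_decomp_exists[of T w] unfolding span by metis
  then have "normal_component T w = p"
    by (intro normal_component_eqI[OF assms(1)]) (simp_all add: orthogonal_commute)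
  moreover have "v \<bullet> t = 0"
    using assms(2)[OF t(1)] by (simp add: orthogonal_def inner_commute)
  ultimately show ?thesis
    by (simp add: t(3) inner_add_right)
qed

text \<open>
  The inverse of the metric matrix is \<open>\<Sum> s\<^sub>b s\<^sub>b\<^sup>T\<close> when the vectors \<open>s\<^sub>b\<close> are the preimages
  of an orthonormal basis of the tangent plane. So the contraction with \<open>g\<^sup>i\<^sup>j\<close> becomes a sum of
  pure second derivatives along the \<open>s\<^sub>b\<close>, which is the form that a second derivative test along
  straight lines in the parameter domain can use.
\<close>

lemma inner_mean_curvature_vector:
  fixes \<phi> :: "real^'n \<Rightarrow> 'n ambient"
  assumes "open V" "x \<in> V" and smooth: "times_differentiable_on (Suc (Suc 0)) \<phi> V"
    and inj: "inj (frechet_derivative \<phi> (at x))"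
    and "finite B" "pairwise orthogonal B" "\<And>b. b \<in> B \<Longrightarrow> norm b = 1" "span B = tangent_plane \<phi> x"
    and s: "\<And>b. b \<in> B \<Longrightarrow> frechet_derivative \<phi> (at x) (s b) = b"
    and normal: "\<And>t. t \<in> tangent_plane \<phi> x \<Longrightarrow> orthogonal t v"
  shows "v \<bullet> mean_curvature_vector \<phi> x =
    (\<Sum>b\<in>B. v \<bullet> frechet_derivative (\<lambda>y. frechet_derivative \<phi> (at y) (s b)) (at x) (s b))"
proof -
  define d where "d y = frechet_derivative \<phi> (at y)" for y
  define d2 where "d2 u w = frechet_derivative (\<lambda>y. d y w) (at x) u" for u w
  have d: "(\<phi> has_derivative d y) (at y)" "linear (d y)" if "y \<in> V" for y
    using smooth that by (auto simp: d_def frechet_derivative_works dest: has_derivative_linear)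
  have d2: "((\<lambda>y. d y w) has_derivative (\<lambda>u. d2 u w)) (at x)" for w
    using smooth \<open>x \<in> V\<close> by (simp add: d2_def d_def frechet_derivative_works)
  have lin2: "linear (\<lambda>u. d2 u w)" for w
    using d2 has_derivative_linear by blast
  \<comment> \<open>Linearity in the direction that is differentiated first holds because it holds at every point of \<open>V\<close>.\<close>
  have lin1: "d2 u w = (\<Sum>j\<in>UNIV. (w $ j) *\<^sub>R d2 u (axis j 1))" for u w
  proof -
    have expand: "(\<Sum>j\<in>UNIV. (w $ j) *\<^sub>R d y (axis j 1)) = d y w" if "y \<in> V" for y
      using arg_cong[OF basis_expansion[of w], of "d y"]
      by (simp add: scalar_mult_eq_scaleR linear_sum[OF d(2)[OF that]] linear_cmul[OF d(2)[OF that]])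
    have "((\<lambda>y. \<Sum>j\<in>UNIV. (w $ j) *\<^sub>R d y (axis j 1)) has_derivative
        (\<lambda>u. \<Sum>j\<in>UNIV. (w $ j) *\<^sub>R d2 u (axis j 1))) (at x)"
      by (intro has_derivative_sum has_derivative_scaleR_right d2)
    then have "((\<lambda>y. d y w) has_derivative (\<lambda>u. \<Sum>j\<in>UNIV. (w $ j) *\<^sub>R d2 u (axis j 1))) (at x)"
      by (rule has_derivative_transform_within_open[OF _ \<open>open V\<close> \<open>x \<in> V\<close> expand])
    from fun_cong[OF has_derivative_unique[OF d2 this], of u] show ?thesis
      by simp
  qed
  have bilinear: "d2 u w = (\<Sum>i\<in>UNIV. \<Sum>j\<in>UNIV. (u $ i * w $ j) *\<^sub>R d2 (axis i 1) (axis j 1))" for u w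
  proof -
    have "d2 u w = (\<Sum>i\<in>UNIV. (u $ i) *\<^sub>R d2 (axis i 1) w)"
      using arg_cong[OF basis_expansion[of u], of "\<lambda>u. d2 u w"]
      by (simp add: scalar_mult_eq_scaleR linear_sum[OF lin2] linear_cmul[OF lin2])
    also have "\<dots> = (\<Sum>i\<in>UNIV. (u $ i) *\<^sub>R (\<Sum>j\<in>UNIV. (w $ j) *\<^sub>R d2 (axis i 1) (axis j 1)))"
      by (simp add: lin1[of _ w])
    finally show ?thesis
      by (simp add: scaleR_sum_right)
  qed
  define N where "N = (\<chi> i j. \<Sum>b\<in>B. s b $ i * s b $ j)"
  have lin: "linear (d x)" using d(2)[OF \<open>x \<in> V\<close>] .
  have ds: "d x (s b) = b" if "b \<in> B" for b
    using s[OF that] by (simp add: d_def)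
  \<comment> \<open>Row \<open>i\<close> against column \<open>k\<close> is the \<open>i\<close>-th coordinate of the preimage of \<open>d x (axis k 1)\<close> expanded in \<open>B\<close>.\<close>
  have "N ** metric_matrix \<phi> x = mat 1"
  proof -
    have "(N ** metric_matrix \<phi> x) $ i $ k = mat 1 $ i $ k" for i k
    proof -
      define z where "z = d x (axis k 1)"
      have "d x (\<Sum>b\<in>B. (b \<bullet> z) *\<^sub>R s b) = (\<Sum>b\<in>B. (b \<bullet> z) *\<^sub>R b)"
        by (simp add: linear_sum[OF lin] linear_cmul[OF lin] ds)
      also have "\<dots> = z"
        using assms(5-8) by (intro orthonormal_expansion) (auto simp: z_def d_def tangent_plane_def)
      finally have coords: "(\<Sum>b\<in>B. (b \<bullet> z) *\<^sub>R s b) = axis k 1"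
        using inj by (auto simp: d_def z_def dest: injD)
      have contract: "(\<Sum>j\<in>UNIV. s b $ j * (d x (axis j 1) \<bullet> z)) = b \<bullet> z" if "b \<in> B" for b
      proof -
        have "b = d x (\<Sum>j\<in>UNIV. (s b $ j) *\<^sub>R axis j 1)"
          using ds[OF that] basis_expansion[of "s b"] by (simp add: scalar_mult_eq_scaleR)
        then have "b \<bullet> z = (\<Sum>j\<in>UNIV. (s b $ j) *\<^sub>R d x (axis j 1)) \<bullet> z"
          by (simp add: linear_sum[OF lin] linear_cmul[OF lin])
        then show ?thesis by (simp add: inner_sum_left)
      qed
      have "(N ** metric_matrix \<phi> x) $ i $ k = (\<Sum>j\<in>UNIV. \<Sum>b\<in>B. s b $ i * (s b $ j * (d x (axis j 1) \<bullet> z)))"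
        by (simp add: matrix_matrix_mult_def N_def metric_matrix_def d_def z_def sum_distrib_right mult.assoc)
      also have "\<dots> = (\<Sum>b\<in>B. \<Sum>j\<in>UNIV. s b $ i * (s b $ j * (d x (axis j 1) \<bullet> z)))"
        by (rule sum.swap)
      also have "\<dots> = (\<Sum>b\<in>B. s b $ i * (b \<bullet> z))"
        by (simp add: contract sum_distrib_left[symmetric])
      also have "\<dots> = (\<Sum>b\<in>B. (b \<bullet> z) *\<^sub>R s b) $ i"
        by (simp add: mult.commute)
      also have "\<dots> = mat 1 $ i $ k"
        unfolding coords by (simp add: mat_def axis_def)
      finally show ?thesis .
    qed
    then show ?thesis by (simp add: vec_eq_iff)
  qed
  then have inv: "matrix_inv (metric_matrix \<phi> x) = N"
    by (rule matrix_inv_eqI)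
  have "subspace (tangent_plane \<phi> x)"
    unfolding tangent_plane_def using lin d_def by (metis linear_subspace_image subspace_UNIV)
  then have form: "v \<bullet> second_fundamental_form \<phi> x u w = v \<bullet> d2 u w" for u w
    unfolding second_fundamental_form_def d2_def d_def by (rule inner_normal_component) (rule normal)
  have "v \<bullet> mean_curvature_vector \<phi> x = (\<Sum>i\<in>UNIV. \<Sum>j\<in>UNIV. \<Sum>b\<in>B. s b $ i * s b $ j * (v \<bullet> d2 (axis i 1) (axis j 1)))"
    by (simp add: mean_curvature_vector_def inv inner_sum_right form N_def sum_distrib_right)
  also have "\<dots> = (\<Sum>i\<in>UNIV. \<Sum>b\<in>B. \<Sum>j\<in>UNIV. s b $ i * s b $ j * (v \<bullet> d2 (axis i 1) (axis j 1)))"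
    by (intro sum.cong refl sum.swap)
  also have "\<dots> = (\<Sum>b\<in>B. \<Sum>i\<in>UNIV. \<Sum>j\<in>UNIV. s b $ i * s b $ j * (v \<bullet> d2 (axis i 1) (axis j 1)))"
    by (rule sum.swap)
  also have "\<dots> = (\<Sum>b\<in>B. v \<bullet> d2 (s b) (s b))"
    by (intro sum.cong refl) (simp add: bilinear[of "s b" "s b" for b] inner_sum_right)
  finally show ?thesis
    by (simp add: d2_def d_def)
qed

lemma second_derivative_nonpos_at_local_max:
  fixes \<phi> \<phi>' :: "real \<Rightarrow> real"
  assumes "d > 0" and "\<And>t. \<bar>t\<bar> < d \<Longrightarrow> (\<phi> has_real_derivative \<phi>' t) (at t)"
    and "(\<phi>' has_real_derivative l) (at 0)" and max: "\<And>t. \<bar>t\<bar> < d \<Longrightarrow> \<phi> t \<le> \<phi> 0"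
  shows "\<phi>' 0 = 0" and "l \<le> 0"
proof -
  show 0: "\<phi>' 0 = 0"
    using DERIV_local_max[of \<phi> "\<phi>' 0" 0 d] assms by simp
  show "l \<le> 0"
  proof (rule ccontr)
    assume "\<not> l \<le> 0"
    then obtain e where e: "e > 0" and pos: "\<And>t. 0 < t \<Longrightarrow> t < e \<Longrightarrow> 0 < \<phi>' t"
      using DERIV_pos_inc_right[OF assms(3)] 0 by auto
    define t where "t = min d e / 2"
    have t: "0 < t" "t < d" "t < e" using \<open>d > 0\<close> e by (auto simp: t_def)
    obtain s where "0 < s" "s < t" "\<phi> t - \<phi> 0 = (t - 0) * \<phi>' s"
      using MVT2[of 0 t \<phi> \<phi>'] t assms(2) by auto
    moreover have "\<phi> t \<le> \<phi> 0" using max t by simp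
    ultimately show False using pos[of s] t by (metis diff_le_0_iff_le diff_zero less_trans mult_pos_pos not_less)
  qed
qed

text \<open>
  Here \<open>g\<close> is the gradient and \<open>h\<close> the Hessian, as a linear map, of an ambient function at a
  point, and \<open>\<nu>\<close> is a unit normal there. At a critical point of the restriction to a translator
  the value is \<open>\<Delta> f + \<langle>\<nabla> f, e_last\<rangle>\<close> for the intrinsic Laplacian and gradient. The formula
  makes sense for any \<open>\<nu>\<close>; the estimates below hold for all unit vectors.
\<close>

definition drift_laplacian :: "'n::finite ambient \<Rightarrow> 'n ambient \<Rightarrow> ('n ambient \<Rightarrow> 'n ambient) \<Rightarrow> real" where
  "drift_laplacian \<nu> g h = (\<Sum>b\<in>Basis. b \<bullet> h b) - \<nu> \<bullet> h \<nu> + g \<bullet> e_last"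

text \<open>
  Along the line with direction \<open>s\<^sub>b\<close> in the parameter domain the second derivative of
  \<open>f \<circ> \<phi>\<close> is \<open>D\<^sup>2 f(b, b)\<close> plus the gradient paired with the second derivative of \<open>\<phi>\<close>.
  Summed over an orthonormal basis of the tangent plane, the first terms give the tangential
  trace. The second terms give the gradient paired with the mean curvature vector, which the
  translator equation turns into the vertical derivative of \<open>f\<close>, since the gradient is normal
  at a maximum.
\<close>

lemma drift_laplacian_nonpos_at_local_max:
  fixes \<phi> :: "real^'n \<Rightarrow> 'n ambient"
  assumes V: "open V" "x \<in> V" and smooth: "times_differentiable_on (Suc (Suc 0)) \<phi> V"
    and inj: "inj (frechet_derivative \<phi> (at x))"
    and translator: "\<And>\<nu>. unit_normal \<phi> x \<nu> \<Longrightarrow> mean_curvature_vector \<phi> x = (e_last \<bullet> \<nu>) *\<^sub>R \<nu>"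
    and max: "\<And>y. y \<in> V \<Longrightarrow> f (\<phi> y) \<le> (f (\<phi> x) :: real)"
    and f: "\<And>z. (f has_derivative (\<lambda>k. g z \<bullet> k)) (at z)"
    and g: "(g has_derivative h) (at (\<phi> x))"
  obtains \<nu> where "norm \<nu> = 1" "drift_laplacian \<nu> (g (\<phi> x)) h \<le> 0"
proof -
  define d where "d y = frechet_derivative \<phi> (at y)" for y
  define d2 where "d2 s = frechet_derivative (\<lambda>y. d y s) (at x) s" for s
  define T where "T = tangent_plane \<phi> x"
  have d: "(\<phi> has_derivative d y) (at y)" if "y \<in> V" for y
    using smooth that by (auto simp: d_def frechet_derivative_works)
  have d2: "((\<lambda>y. d y s) has_derivative frechet_derivative (\<lambda>y. d y s) (at x)) (at x)" for s
    using smooth \<open>x \<in> V\<close> by (simp add: d_def frechet_derivative_works)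
  have lin: "linear (d x)" using d[OF \<open>x \<in> V\<close>] by (rule has_derivative_linear)
  have T: "T = range (d x)" "subspace T"
    using linear_subspace_image[OF lin subspace_UNIV] by (simp_all add: T_def tangent_plane_def d_def)
  obtain B where B: "B \<subseteq> T" "pairwise orthogonal B" "\<And>b. b \<in> B \<Longrightarrow> norm b = 1"
      "independent B" "card B = dim T" "span B = T"
    using orthonormal_basis_subspace[OF T(2)] by blast
  have "finite B" using \<open>independent B\<close> by (rule independent_imp_finite)
  have "dim T = CARD('n)"
    using dim_image_eq[OF lin, of UNIV] inj by (simp add: T(1) d_def)
  then have strict: "span T \<subset> span UNIV"
    using dim_eq_full[of T] by (auto simp: psubset_eq)
  obtain \<nu>\<^sub>0 where \<nu>\<^sub>0: "\<nu>\<^sub>0 \<noteq> 0" "\<And>t. t \<in> T \<Longrightarrow> orthogonal \<nu>\<^sub>0 t"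
    using orthogonal_to_subspace_exists_gen[OF strict] span_base by metis
  define \<nu> where "\<nu> = \<nu>\<^sub>0 /\<^sub>R norm \<nu>\<^sub>0"
  have \<nu>: "norm \<nu> = 1" "\<And>t. t \<in> T \<Longrightarrow> t \<bullet> \<nu> = 0"
    using \<nu>\<^sub>0 by (auto simp: \<nu>_def orthogonal_def inner_commute)
  then have normal: "unit_normal \<phi> x \<nu>"
    by (simp add: unit_normal_def T_def orthogonal_def)
  have "\<nu> \<notin> B" using \<nu> B(1) by (metis norm_eq_1 subsetD zero_neq_one)
  define B' where "B' = insert \<nu> B"
  have B': "finite B'" "pairwise orthogonal B'" "\<And>b. b \<in> B' \<Longrightarrow> norm b = 1"
    using \<open>finite B\<close> B \<nu> by (auto simp: B'_def pairwise_insert orthogonal_def inner_commute)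
  have "0 \<notin> B'" using B'(3) by fastforce
  then have "independent B'" using B'(2) by (simp add: pairwise_orthogonal_independent)
  moreover have "card B' = DIM('n ambient)"
    using \<open>\<nu> \<notin> B\<close> \<open>finite B\<close> B(5) \<open>dim T = CARD('n)\<close> by (simp add: B'_def)
  ultimately have span: "span B' = UNIV"
    using card_ge_dim_independent[of B' UNIV] by (simp add: dim_UNIV top_unique)
  define s where "s b = inv (d x) b" for b
  have s: "d x (s b) = b" if "b \<in> B" for b
    using that B(1) T(1) by (auto simp: s_def f_inv_into_f)
  have test: "g (\<phi> x) \<bullet> d x u = 0 \<and> h (d x u) \<bullet> d x u + g (\<phi> x) \<bullet> d2 u \<le> 0" for u
  proof -
    obtain e where e: "e > 0" "ball x e \<subseteq> V"
      using V by (meson openE)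
    define r where "r = e / (norm u + 1)"
    have "r > 0" using e by (simp add: r_def add_nonneg_pos)
    have inV: "x + t *\<^sub>R u \<in> V" if "\<bar>t\<bar> < r" for t
    proof -
      have "\<bar>t\<bar> * norm u \<le> \<bar>t\<bar> * (norm u + 1)" by (intro mult_left_mono) auto
      also have "\<dots> < e" using that by (simp add: r_def pos_less_divide_eq add_nonneg_pos)
      finally show ?thesis using e by (auto simp: dist_norm)
    qed
    have line: "((\<lambda>t. x + t *\<^sub>R u) has_derivative (\<lambda>k. k *\<^sub>R u)) (at t)" for t
      by (auto intro!: derivative_eq_intros)
    have comp: "((\<lambda>t. \<phi> (x + t *\<^sub>R u)) has_derivative (\<lambda>k. d (x + t *\<^sub>R u) (k *\<^sub>R u))) (at t)" if "\<bar>t\<bar> < r" for t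
      using has_derivative_compose[OF line d[OF inV[OF that]]] .
    have lint: "d y (k *\<^sub>R u) = k *\<^sub>R d y u" if "y \<in> V" for y k
      using linear_cmul[OF has_derivative_linear[OF d[OF that]]] .
    have first: "((\<lambda>t. f (\<phi> (x + t *\<^sub>R u))) has_real_derivative g (\<phi> (x + t *\<^sub>R u)) \<bullet> d (x + t *\<^sub>R u) u) (at t)"
      if "\<bar>t\<bar> < r" for t
    proof -
      have "((\<lambda>t. f (\<phi> (x + t *\<^sub>R u))) has_derivative
          (\<lambda>k. g (\<phi> (x + t *\<^sub>R u)) \<bullet> d (x + t *\<^sub>R u) (k *\<^sub>R u))) (at t)"
        using has_derivative_compose[OF comp[OF that] f] .
      then show ?thesis
        by (simp add: has_field_derivative_def lint inV[OF that] mult_commute_abs)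
    qed
    have "((\<lambda>t. g (\<phi> (x + t *\<^sub>R u)) \<bullet> d (x + t *\<^sub>R u) u) has_derivative
        (\<lambda>k. g (\<phi> (x + 0 *\<^sub>R u)) \<bullet> frechet_derivative (\<lambda>y. d y u) (at x) (k *\<^sub>R u)
           + h (d x (k *\<^sub>R u)) \<bullet> d (x + 0 *\<^sub>R u) u)) (at 0)"
    proof (rule has_derivative_inner)
      show "((\<lambda>t. g (\<phi> (x + t *\<^sub>R u))) has_derivative (\<lambda>k. h (d x (k *\<^sub>R u)))) (at 0)"
        using has_derivative_compose[OF comp[of 0], of g h] g \<open>r > 0\<close> by simp
      show "((\<lambda>t. d (x + t *\<^sub>R u) u) has_derivative (\<lambda>k. frechet_derivative (\<lambda>y. d y u) (at x) (k *\<^sub>R u))) (at 0)"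
        using has_derivative_compose[OF line[of 0], of "\<lambda>y. d y u"] d2[of u] by simp
    qed
    then have "((\<lambda>t. g (\<phi> (x + t *\<^sub>R u)) \<bullet> d (x + t *\<^sub>R u) u) has_derivative
        (\<lambda>k. (h (d x u) \<bullet> d x u + g (\<phi> x) \<bullet> d2 u) * k)) (at 0)"
      using linear_cmul[OF has_derivative_linear[OF g]] linear_cmul[OF has_derivative_linear[OF d2[of u]]]
      by (elim has_derivative_eq_rhs) (simp add: fun_eq_iff lint[OF \<open>x \<in> V\<close>] d2_def algebra_simps)
    then have second: "((\<lambda>t. g (\<phi> (x + t *\<^sub>R u)) \<bullet> d (x + t *\<^sub>R u) u) has_real_derivative
        h (d x u) \<bullet> d x u + g (\<phi> x) \<bullet> d2 u) (at 0)"
      by (simp only: has_field_derivative_def)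
    show ?thesis
      using second_derivative_nonpos_at_local_max[OF \<open>r > 0\<close> first second] max inV by simp
  qed
  have grad: "t \<bullet> g (\<phi> x) = 0" if "t \<in> T" for t
    using test that T(1) by (auto simp: inner_commute)
  \<comment> \<open>The gradient is normal, so only the normal part of \<open>e_last\<close> matters, and this is the mean curvature vector.\<close>
  have "(e_last - (e_last \<bullet> \<nu>) *\<^sub>R \<nu>) \<in> T"
  proof -
    have "(\<Sum>b\<in>B'. (b \<bullet> e_last) *\<^sub>R b) = e_last"
      using orthonormal_expansion[OF B', of e_last] span by simp
    then have "e_last - (e_last \<bullet> \<nu>) *\<^sub>R \<nu> = (\<Sum>b\<in>B. (b \<bullet> e_last) *\<^sub>R b)"
      using \<open>\<nu> \<notin> B\<close> \<open>finite B\<close> by (simp add: B'_def inner_commute algebra_simps)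
    also have "\<dots> \<in> T"
      using B(1) T(2) by (intro subspace_sum subspace_scale) auto
    finally show ?thesis .
  qed
  from grad[OF this] have "g (\<phi> x) \<bullet> e_last = g (\<phi> x) \<bullet> mean_curvature_vector \<phi> x"
    by (simp add: translator[OF normal] inner_diff_right inner_diff_left inner_commute)
  also have "\<dots> = (\<Sum>b\<in>B. g (\<phi> x) \<bullet> d2 (s b))"
    unfolding d2_def d_def
    by (rule inner_mean_curvature_vector[OF V smooth inj \<open>finite B\<close> B(2,3)])
      (use B(6) T_def s grad in \<open>auto simp: d_def orthogonal_def\<close>)
  finally have H: "g (\<phi> x) \<bullet> e_last = (\<Sum>b\<in>B. g (\<phi> x) \<bullet> d2 (s b))" .
  have "(\<Sum>b\<in>Basis. b \<bullet> h b) = (\<Sum>b\<in>B'. b \<bullet> h b)"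
    using trace_orthonormal_basis[OF B' span has_derivative_linear[OF g]] by simp
  also have "\<dots> = \<nu> \<bullet> h \<nu> + (\<Sum>b\<in>B. b \<bullet> h b)"
    using \<open>\<nu> \<notin> B\<close> \<open>finite B\<close> by (simp add: B'_def)
  finally have "drift_laplacian \<nu> (g (\<phi> x)) h = (\<Sum>b\<in>B. b \<bullet> h b + g (\<phi> x) \<bullet> d2 (s b))"
    by (simp add: drift_laplacian_def H sum.distrib)
  also have "\<dots> \<le> 0"
  proof (rule sum_nonpos)
    fix b assume "b \<in> B"
    then show "b \<bullet> h b + g (\<phi> x) \<bullet> d2 (s b) \<le> 0"
      using test[of "s b"] s[of b] by (simp add: inner_commute)
  qed
  finally show thesis
    using that \<nu>(1) by blast
qed

section \<open>Maximum principle for weak translators\<close>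

text \<open>
  The maximum principle for test functions, in the style of viscosity solutions. It depends on
  the set of points alone, so immersion, charts and self-intersections need not be mentioned in
  the estimates.
\<close>

definition weak_translator :: "'n::finite ambient set \<Rightarrow> bool" where
  "weak_translator M \<longleftrightarrow>
     (\<forall>f g h U y. open U \<longrightarrow> y \<in> M \<inter> U \<longrightarrow> (\<forall>z\<in>M \<inter> U. f z \<le> (f y :: real)) \<longrightarrow>
        (\<forall>z. (f has_derivative (\<lambda>k. g z \<bullet> k)) (at z)) \<longrightarrow> (g has_derivative h) (at y) \<longrightarrow>
        (\<exists>\<nu>. norm \<nu> = 1 \<and> drift_laplacian \<nu> (g y) h \<le> 0))"

text \<open>
  A limit point of \<open>M\<close> outside \<open>M\<close> lies in \<open>C\<close>, where the test function is below its value at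
  \<open>x\<close>. So the superlevel set through \<open>x\<close> is compact, and
  a maximum over it lies in the interior of \<open>D\<close>.
\<close>

lemma weak_translator_maximum_principle:
  fixes f :: "'n::finite ambient \<Rightarrow> real"
  assumes "weak_translator M" and "closed (M \<union> C)" and "closed D" and x: "x \<in> M \<inter> D"
    and bdd: "bounded {y \<in> M \<inter> D. f x \<le> f y}"
    and lessC: "\<And>y. y \<in> C \<inter> D \<Longrightarrow> f y < f x"
    and less_frontier: "\<And>y. y \<in> M \<inter> D - interior D \<Longrightarrow> f y < f x"
    and f: "\<And>y. (f has_derivative (\<lambda>k. g y \<bullet> k)) (at y)"
    and g: "\<And>y. (g has_derivative h y) (at y)"
  obtains y \<nu> where "y \<in> M \<inter> D" "norm \<nu> = 1" "drift_laplacian \<nu> (g y) (h y) \<le> 0"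
proof -
  let ?S = "{y \<in> M \<inter> D. f x \<le> f y}"
  have cont: "continuous_on UNIV f"
    using f by (meson continuous_at_imp_continuous_on has_derivative_continuous)
  have "?S = (M \<union> C) \<inter> D \<inter> {y. f x \<le> f y}"
    using lessC by force
  moreover have "closed {y. f x \<le> f y}"
    using cont by (simp add: closed_Collect_le)
  ultimately have "closed ?S"
    using assms(2,3) by (simp add: closed_Int)
  with bdd have "compact ?S"
    by (simp add: compact_eq_bounded_closed)
  moreover have "x \<in> ?S"
    using x by simp
  ultimately obtain y where y: "y \<in> ?S" and max: "\<And>z. z \<in> ?S \<Longrightarrow> f z \<le> f y"
    using continuous_attains_sup[of ?S f] cont continuous_on_subset by blast
  have "y \<in> interior D"
    using less_frontier[of y] y by fastforce
  moreover have "f z \<le> f y" if "z \<in> M \<inter> interior D" for z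
    using max[of z] y that interior_subset[of D] by force
  ultimately obtain \<nu> where "norm \<nu> = 1" "drift_laplacian \<nu> (g y) (h y) \<le> 0"
    using assms(1) f g y unfolding weak_translator_def by (metis (no_types, lifting) Int_iff mem_Collect_eq open_interior)
  with y that show thesis by blast
qed

section \<open>Barriers in a wedge\<close>

text \<open>
  The lens cut out of the wedge near its vertex by a circle of radius \<open>A\<close> around a point far
  inside is the region where the quadratic part of the test function \<open>f\<close> exceeds
  \<open>- A\<^sup>2 / 2\<close>. It exhausts the wedge as \<open>A\<close> grows, so every point \<open>x\<close> is eventually inside
  with room to spare: the quadratic part at \<open>x\<close> decreases only linearly in \<open>A\<close>. The
  exponential shields the test function from what happens at the level \<open>c\<close>, and \<open>\<eta> p\<close> makes it tend to minus infinity along the remaining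
  directions at a small cost in the drift Laplacian.
\<close>

lemma wedge_height_bounded:
  fixes M C :: "'n::finite ambient set"
  assumes M: "weak_translator M" "closed (M \<union> C)"
    and C: "\<And>x. x \<in> C \<Longrightarrow> x \<bullet> e_last < c"
    and w: "norm w\<^sub>1 = 1" "norm w\<^sub>2 = 1" "w\<^sub>1 \<bullet> e_last = 0" "w\<^sub>2 \<bullet> e_last = 0"
    and indep: "\<bar>w\<^sub>1 \<bullet> w\<^sub>2\<bar> < 1"
    and wedge: "M \<subseteq> halfspace b\<^sub>1 w\<^sub>1 \<inter> halfspace b\<^sub>2 w\<^sub>2"
    and x: "x \<in> M"
  shows "x \<bullet> e_last \<le> c + 1"
proof (rule ccontr)
  assume high: "\<not> x \<bullet> e_last \<le> c + 1"
  define l\<^sub>1 l\<^sub>2 where "l\<^sub>1 y = (y - b\<^sub>1) \<bullet> w\<^sub>1" and "l\<^sub>2 y = (y - b\<^sub>2) \<bullet> w\<^sub>2" for y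
  have l_nonneg: "0 \<le> l\<^sub>1 y" "0 \<le> l\<^sub>2 y" if "y \<in> M" for y
    using wedge that by (auto simp: l\<^sub>1_def l\<^sub>2_def halfspace_def)
  define \<kappa> where "\<kappa> = 1 - \<bar>w\<^sub>1 \<bullet> w\<^sub>2\<bar>"
  \<comment> \<open>The function \<open>p\<close> has drift Laplacian at most \<open>n + 1\<close>, so \<open>\<eta> p\<close> uses up at most half of the gain \<open>\<kappa>\<close>.\<close>
  define \<eta> where "\<eta> = \<kappa> / (2 * (real CARD('n) + 1))"
  have "\<kappa> > 0" using indep by (simp add: \<kappa>_def)
  then have "\<eta> > 0" by (simp add: \<eta>_def)
  have \<eta>_small: "\<eta> * (real CARD('n) + 1) < \<kappa>"
    using \<open>\<kappa> > 0\<close> by (simp add: \<eta>_def field_simps add_pos_nonneg)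
  define p where "p y = y \<bullet> e_last - c + (norm (horizontal_part y))\<^sup>2 / 2" for y :: "'n ambient"
  define q where "q = l\<^sub>1 x + l\<^sub>2 x"
  \<comment> \<open>The exponential costs at most \<open>A\<^sup>2 / 4\<close> at \<open>x\<close>; the last condition keeps the linear losses below the other quarter.\<close>
  obtain A where A: "A > 1" "A > q" "A / 4 > q + \<eta> * \<bar>p x\<bar>"
  proof
    let ?A = "2 + \<bar>q\<bar> + 4 * (\<bar>q\<bar> + \<eta> * \<bar>p x\<bar>)"
    have "\<eta> * \<bar>p x\<bar> \<ge> 0" using \<open>\<eta> > 0\<close> by simp
    then show "?A > 1" "?A > q" "?A / 4 > q + \<eta> * \<bar>p x\<bar>" by (auto simp: field_simps)
  qed
  define D where "D = {y. l\<^sub>1 y + l\<^sub>2 y \<le> A \<and> c \<le> y \<bullet> e_last}"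
  define f where "f y = (l\<^sub>1 y)\<^sup>2 / 2 + (l\<^sub>2 y)\<^sup>2 / 2 - A * (l\<^sub>1 y + l\<^sub>2 y)
      - A\<^sup>2 / 2 * exp (c - y \<bullet> e_last) - \<eta> * p y" for y
  define g where "g y = (l\<^sub>1 y - A) *\<^sub>R w\<^sub>1 + (l\<^sub>2 y - A) *\<^sub>R w\<^sub>2
      + (A\<^sup>2 / 2 * exp (c - y \<bullet> e_last)) *\<^sub>R e_last - \<eta> *\<^sub>R (e_last + horizontal_part y)" for y
  define h where "h y k = (k \<bullet> w\<^sub>1) *\<^sub>R w\<^sub>1 + (k \<bullet> w\<^sub>2) *\<^sub>R w\<^sub>2
      - (A\<^sup>2 / 2 * exp (c - y \<bullet> e_last)) *\<^sub>R ((k \<bullet> e_last) *\<^sub>R e_last) - \<eta> *\<^sub>R horizontal_part k" for y k :: "'n ambient"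
  note horiz_derivative [derivative_intros] = bounded_linear.has_derivative[OF bounded_linear_horizontal_part]
  have f_deriv: "(f has_derivative (\<lambda>k. g y \<bullet> k)) (at y)" for y
    unfolding f_def g_def p_def norm_horizontal_part l\<^sub>1_def l\<^sub>2_def
    by (auto intro!: derivative_eq_intros simp: fun_eq_iff algebra_simps diff_divide_distrib
        inner_commute inner_horizontal_part power2_eq_square)
  have g_deriv: "(g has_derivative h y) (at y)" for y
    unfolding g_def h_def l\<^sub>1_def l\<^sub>2_def
    by (auto intro!: derivative_eq_intros simp: fun_eq_iff algebra_simps)
  have "closed D"
    unfolding D_def l\<^sub>1_def l\<^sub>2_def Collect_conj_eq
    by (intro closed_Int closed_Collect_le continuous_intros)
  have open_sub: "y \<in> interior D" if "l\<^sub>1 y + l\<^sub>2 y < A" "c < y \<bullet> e_last" for y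
  proof (rule interiorI)
    show "open ({y. l\<^sub>1 y + l\<^sub>2 y < A} \<inter> {y. c < y \<bullet> e_last})"
      unfolding l\<^sub>1_def l\<^sub>2_def by (intro open_Int open_Collect_less continuous_intros)
  qed (use that in \<open>auto simp: D_def\<close>)
  have quadratic_nonpos: "t\<^sup>2 / 2 - A * t \<le> 0" if "0 \<le> t" "t \<le> A" for t
    using mult_right_mono[of t A t] mult_right_mono[of t "2 * A" t] that A by (simp add: power2_eq_square)
  have f_le: "f y \<le> - (A\<^sup>2 / 2 * exp (c - y \<bullet> e_last)) - \<eta> * p y" if "y \<in> M \<inter> D" for y
    using quadratic_nonpos[of "l\<^sub>1 y"] quadratic_nonpos[of "l\<^sub>2 y"] l_nonneg[of y] that
    by (simp add: f_def D_def algebra_simps)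
  have p_nonneg: "0 \<le> p y" if "y \<in> D" for y
    using that by (simp add: p_def D_def)
  have fx: "- A\<^sup>2 / 2 < f x"
  proof -
    have "exp (c - x \<bullet> e_last) \<le> exp (-1)" using high by simp
    also have "\<dots> \<le> 1 / 2"
      using exp_ge_add_one_self[of "1::real"] by (simp add: exp_minus field_simps)
    finally have "A\<^sup>2 / 2 * exp (c - x \<bullet> e_last) \<le> A\<^sup>2 / 4"
      using mult_left_mono[of "exp (c - x \<bullet> e_last)" "1/2" "A\<^sup>2 / 2"] by simp
    moreover have "A * (q + \<eta> * \<bar>p x\<bar>) < A * (A / 4)"
      using A by (intro mult_strict_left_mono) auto
    moreover have "\<eta> * p x \<le> A * (\<eta> * \<bar>p x\<bar>)"
      using A \<open>\<eta> > 0\<close> mult_right_mono[of 1 A "\<eta> * \<bar>p x\<bar>"] mult_left_mono[of "p x" "\<bar>p x\<bar>" \<eta>] by simp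
    moreover have "f x = (l\<^sub>1 x)\<^sup>2 / 2 + (l\<^sub>2 x)\<^sup>2 / 2 - A * q - A\<^sup>2 / 2 * exp (c - x \<bullet> e_last) - \<eta> * p x"
      by (simp add: f_def q_def)
    moreover have "A * (q + \<eta> * \<bar>p x\<bar>) = A * q + A * (\<eta> * \<bar>p x\<bar>)" "A * (A / 4) = A\<^sup>2 / 4"
      by (simp_all add: distrib_left power2_eq_square)
    ultimately show ?thesis
      using zero_le_power2[of "l\<^sub>1 x"] zero_le_power2[of "l\<^sub>2 x"] by linarith
  qed
  have xD: "x \<in> M \<inter> D"
    using x high A by (simp add: D_def q_def)
  have bdd: "bounded {y \<in> M \<inter> D. f x \<le> f y}"
  proof (rule bounded_cylinder)
    fix y assume y: "y \<in> {y \<in> M \<inter> D. f x \<le> f y}"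
    then have "f x \<le> - (A\<^sup>2 / 2 * exp (c - y \<bullet> e_last)) - \<eta> * p y"
      using f_le[of y] by auto
    moreover have "0 \<le> A\<^sup>2 / 2 * exp (c - y \<bullet> e_last)"
      by simp
    ultimately have "f x \<le> - \<eta> * p y"
      by linarith
    then have "p y \<le> - f x / \<eta>"
      using \<open>\<eta> > 0\<close> by (simp add: field_simps)
    moreover have "c \<le> y \<bullet> e_last" using y by (simp add: D_def)
    ultimately show "(norm (horizontal_part y))\<^sup>2 \<le> 2 * (- f x / \<eta>)" "\<bar>y \<bullet> e_last\<bar> \<le> \<bar>c\<bar> + \<bar>- f x / \<eta>\<bar>"
      unfolding p_def using zero_le_power2[of "norm (horizontal_part y)"] by - linarith+
  qed
  have lessC: "f y < f x" if "y \<in> C \<inter> D" for y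
    using C[of y] that by (simp add: D_def)
  have lessF: "f y < f x" if "y \<in> M \<inter> D - interior D" for y
  proof -
    have "y \<bullet> e_last = c \<or> l\<^sub>1 y + l\<^sub>2 y = A"
      using that open_sub[of y] by (force simp: D_def)
    then have "f y \<le> - A\<^sup>2 / 2"
    proof
      assume "y \<bullet> e_last = c"
      then show ?thesis
        using f_le[of y] that \<open>\<eta> > 0\<close> p_nonneg[of y] order_trans[of "f y" "- A\<^sup>2 / 2 - \<eta> * p y" "- A\<^sup>2 / 2"]
        by simp
    next
      assume s: "l\<^sub>1 y + l\<^sub>2 y = A"
      \<comment> \<open>The segment \<open>l\<^sub>1 + l\<^sub>2 = A\<close> lies in the disc of radius \<open>A\<close> around \<open>(A, A)\<close>.\<close>
      have "A\<^sup>2 = (l\<^sub>1 y)\<^sup>2 + (l\<^sub>2 y)\<^sup>2 + 2 * (l\<^sub>1 y * l\<^sub>2 y)"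
        by (simp add: s[symmetric] power2_eq_square algebra_simps)
      moreover have "0 \<le> l\<^sub>1 y * l\<^sub>2 y" "0 \<le> \<eta> * p y" "0 \<le> A\<^sup>2 / 2 * exp (c - y \<bullet> e_last)"
        using l_nonneg[of y] p_nonneg[of y] that \<open>\<eta> > 0\<close> by auto
      moreover have "f y = (l\<^sub>1 y)\<^sup>2 / 2 + (l\<^sub>2 y)\<^sup>2 / 2 - A\<^sup>2 - A\<^sup>2 / 2 * exp (c - y \<bullet> e_last) - \<eta> * p y"
        by (simp add: f_def s power2_eq_square)
      ultimately show ?thesis by linarith
    qed
    with fx show ?thesis by simp
  qed
  obtain y \<nu> where y: "y \<in> M \<inter> D" "norm \<nu> = 1" and neg: "drift_laplacian \<nu> (g y) (h y) \<le> 0"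
    by (rule weak_translator_maximum_principle[OF M \<open>closed D\<close> xD bdd lessC lessF f_deriv g_deriv])
  define B where "B = A\<^sup>2 / 2 * exp (c - y \<bullet> e_last)"
  have hB: "h y k = (k \<bullet> w\<^sub>1) *\<^sub>R w\<^sub>1 + (k \<bullet> w\<^sub>2) *\<^sub>R w\<^sub>2 - B *\<^sub>R ((k \<bullet> e_last) *\<^sub>R e_last) - \<eta> *\<^sub>R horizontal_part k" for k
    by (simp add: h_def B_def)
  have gB: "g y = (l\<^sub>1 y - A) *\<^sub>R w\<^sub>1 + (l\<^sub>2 y - A) *\<^sub>R w\<^sub>2 + B *\<^sub>R e_last - \<eta> *\<^sub>R (e_last + horizontal_part y)"
    by (simp add: g_def B_def)
  have "(\<Sum>b\<in>Basis. b \<bullet> h y b) = (\<Sum>b\<in>Basis. b \<bullet> ((b \<bullet> w\<^sub>1) *\<^sub>R w\<^sub>1)) + (\<Sum>b\<in>Basis. b \<bullet> ((b \<bullet> w\<^sub>2) *\<^sub>R w\<^sub>2))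
      - B * (\<Sum>b\<in>(Basis :: 'n ambient set). b \<bullet> ((b \<bullet> e_last) *\<^sub>R e_last))
      - \<eta> * (\<Sum>b\<in>(Basis :: 'n ambient set). b \<bullet> horizontal_part b)"
    unfolding hB by (simp add: inner_add_right inner_diff_right sum.distrib sum_subtractf sum_distrib_left mult.assoc)
  then have trace: "(\<Sum>b\<in>Basis. b \<bullet> h y b) = 2 - B - \<eta> * CARD('n)"
    unfolding trace_rank_one trace_horizontal_part using w by simp
  have "drift_laplacian \<nu> (g y) (h y)
      = 2 - (\<nu> \<bullet> w\<^sub>1)\<^sup>2 - (\<nu> \<bullet> w\<^sub>2)\<^sup>2 + B * (\<nu> \<bullet> e_last)\<^sup>2 - \<eta> * (real CARD('n) + 1 - \<nu> \<bullet> horizontal_part \<nu>)"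
    unfolding drift_laplacian_def trace
    by (simp add: gB hB inner_diff_right inner_add_right inner_diff_left inner_add_left
        inner_horizontal_part(3) w power2_eq_square algebra_simps)
  moreover have "B * (\<nu> \<bullet> e_last)\<^sup>2 \<ge> 0" by (simp add: B_def)
  moreover have "\<eta> * (real CARD('n) + 1 - \<nu> \<bullet> horizontal_part \<nu>) \<le> \<eta> * (real CARD('n) + 1)"
    using horizontal_part_unit_bounds[OF y(2)] \<open>\<eta> > 0\<close> by simp
  ultimately show False
    using neg sum_squares_inner_unit[OF y(2) w(1,2)] \<eta>_small by (simp add: \<kappa>_def)
qed

text \<open>
  For \<open>n = 1\<close> there are only two horizontal unit vectors, and they are antiparallel.
\<close>

lemma two_dimensional_if_transverse:
  fixes w\<^sub>1 w\<^sub>2 :: "'n::finite ambient"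
  assumes w: "norm w\<^sub>1 = 1" "norm w\<^sub>2 = 1" "w\<^sub>1 \<bullet> e_last = 0" "w\<^sub>2 \<bullet> e_last = 0"
    and transverse: "w\<^sub>1 \<noteq> w\<^sub>2" "w\<^sub>1 \<noteq> - w\<^sub>2"
  shows "CARD('n) \<ge> 2"
proof (rule ccontr)
  assume "\<not> CARD('n) \<ge> 2"
  then have "CARD('n) = 1"
    using zero_less_card_finite[where 'a='n] by linarith
  then obtain i :: 'n where i: "UNIV = {i}"
    by (rule card_1_singletonE)
  have only: "j = i" for j
    using i by blast
  have ext: "u = v" if "fst u $ i = fst v $ i" "snd u = snd v" for u v :: "'n ambient"
  proof -
    have "fst u = fst v"
      unfolding vec_eq_iff using that(1) only by metis
    with that(2) show ?thesis by (simp add: prod_eq_iff)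
  qed
  have "snd w\<^sub>1 = 0" "snd w\<^sub>2 = 0"
    using w by (simp_all add: e_last_def inner_prod_def)
  moreover have "(fst w\<^sub>1 $ i)\<^sup>2 = 1" "(fst w\<^sub>2 $ i)\<^sup>2 = 1"
    using w \<open>snd w\<^sub>1 = 0\<close> \<open>snd w\<^sub>2 = 0\<close>
    by (simp_all add: norm_eq_1 inner_prod_def inner_vec_def i power2_eq_square)
  ultimately have "w\<^sub>1 = w\<^sub>2 \<or> w\<^sub>1 = - w\<^sub>2"
    using ext[of w\<^sub>1 w\<^sub>2] ext[of w\<^sub>1 "- w\<^sub>2"] by (auto simp: power2_eq_1_iff)
  with transverse show False by blast
qed

text \<open>
  The height enters \<open>v\<close> with a negative sign, which costs \<open>1\<close> in the drift Laplacian, while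
  \<open>r\<^sup>2\<close> contributes at least \<open>2 (n - 1)\<close>. In \<open>u\<close> the coefficient of \<open>r\<^sup>2\<close> is so small that
  the vertical derivative dominates; then \<open>u\<close> is superharmonic for the drift Laplacian, and the
  gradient term in \<open>L (u\<^sup>2)\<close>, which grows at most linearly in \<open>u\<close>, is absorbed.
\<close>

lemma weak_translator_bounded:
  fixes M C :: "'n::finite ambient set"
  assumes M: "weak_translator M" "closed (M \<union> C)" and C: "compact C"
    and dim: "CARD('n) \<ge> 2"
    and below: "\<And>x. x \<in> M \<Longrightarrow> x \<bullet> e_last \<le> c"
  shows "bounded M"
proof -
  define n where "n = real CARD('n)"
  define a where "a = 1 / (16 * n)"
  have n: "n \<ge> 2" using dim by (simp add: n_def)
  then have a: "0 < a" "a \<le> 1 / 32" "a * n = 1 / 16" by (auto simp: a_def field_simps)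
  define u v where "u y = c - y \<bullet> e_last + a * (norm (horizontal_part y))\<^sup>2"
    and "v y = c - y \<bullet> e_last + (norm (horizontal_part y))\<^sup>2" for y :: "'n ambient"
  have uv: "a * v y \<le> u y" "a * (norm (horizontal_part y))\<^sup>2 \<le> u y" "0 \<le> u y" if "y \<in> M" for y
  proof -
    have "a * (c - y \<bullet> e_last) \<le> 1 * (c - y \<bullet> e_last)"
      using a below[OF that] by (intro mult_right_mono) auto
    moreover have "0 \<le> a * (norm (horizontal_part y))\<^sup>2"
      using a by simp
    ultimately show "a * v y \<le> u y" "a * (norm (horizontal_part y))\<^sup>2 \<le> u y" "0 \<le> u y"
      using below[OF that] unfolding u_def v_def by (simp_all add: distrib_left add_increasing)
  qed
  have "continuous_on C v"
    unfolding v_def norm_horizontal_part horizontal_part_def by (intro continuous_intros)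
  then have "bdd_above (v ` C)"
    using C by (intro bounded_imp_bdd_above compact_imp_bounded compact_continuous_image)
  then obtain m where m: "\<And>y. y \<in> C \<Longrightarrow> v y \<le> m"
    unfolding bdd_above_def by auto
  have penalised: "v x - \<epsilon> * (u x)\<^sup>2 \<le> m" if x: "x \<in> M" and \<epsilon>: "0 < \<epsilon>" "\<epsilon> < 1 / 2" for x \<epsilon>
  proof (rule ccontr)
    assume large: "\<not> v x - \<epsilon> * (u x)\<^sup>2 \<le> m"
    define f where "f y = v y - \<epsilon> * (u y)\<^sup>2" for y
    define gu where "gu y = (2 * a) *\<^sub>R horizontal_part y - e_last" for y :: "'n ambient"
    define g where "g y = 2 *\<^sub>R horizontal_part y - e_last - (2 * \<epsilon> * u y) *\<^sub>R gu y" for y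
    define h where "h y k = 2 *\<^sub>R horizontal_part k - (2 * \<epsilon>) *\<^sub>R ((k \<bullet> gu y) *\<^sub>R gu y) - (4 * \<epsilon> * a * u y) *\<^sub>R horizontal_part k" for y k
    note horiz_derivative [derivative_intros] = bounded_linear.has_derivative[OF bounded_linear_horizontal_part]
    have u_deriv [derivative_intros]: "(u has_derivative (\<lambda>k. gu y \<bullet> k)) (at y)" for y
      unfolding u_def gu_def norm_horizontal_part
      by (auto intro!: derivative_eq_intros simp: fun_eq_iff algebra_simps inner_commute inner_horizontal_part)
    have v_deriv [derivative_intros]: "(v has_derivative (\<lambda>k. (2 *\<^sub>R horizontal_part y - e_last) \<bullet> k)) (at y)" for y
      unfolding v_def norm_horizontal_part
      by (auto intro!: derivative_eq_intros simp: fun_eq_iff algebra_simps inner_commute inner_horizontal_part)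
    have f_deriv: "(f has_derivative (\<lambda>k. g y \<bullet> k)) (at y)" for y
      unfolding f_def g_def
      by (auto intro!: derivative_eq_intros simp: fun_eq_iff algebra_simps)
    have gu_deriv [derivative_intros]: "(gu has_derivative (\<lambda>k. (2 * a) *\<^sub>R horizontal_part k)) (at y)" for y
      unfolding gu_def by (auto intro!: derivative_eq_intros)
    have g_deriv: "(g has_derivative h y) (at y)" for y
      unfolding g_def h_def
      by (auto intro!: derivative_eq_intros simp: fun_eq_iff algebra_simps inner_commute)
    have bdd: "bounded {y \<in> M \<inter> UNIV. f x \<le> f y}"
    proof (rule bounded_cylinder)
      fix y assume y: "y \<in> {y \<in> M \<inter> UNIV. f x \<le> f y}"
      \<comment> \<open>Since \<open>v \<le> u / a\<close>, the values \<open>v - \<epsilon> u\<^sup>2\<close> drop below \<open>- u\<close> once \<open>\<epsilon> u > 2 / a\<close>.\<close>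
      define s where "s = 2 / (a * \<epsilon>) + (\<bar>f x\<bar> + 1)"
      have "u y \<le> s"
      proof (rule ccontr)
        assume "\<not> u y \<le> s"
        moreover have "0 < 2 / (a * \<epsilon>)" using a \<epsilon> by simp
        ultimately have *: "2 / (a * \<epsilon>) < u y" "\<bar>f x\<bar> + 1 < u y" unfolding s_def by - linarith+
        have "1 / a + 1 / a < \<epsilon> * u y" using *(1) a \<epsilon> by (simp add: field_simps)
        moreover have "1 / a \<ge> 1" using a by simp
        ultimately have "u y * 1 \<le> u y * (\<epsilon> * u y - 1 / a)"
          using * by (intro mult_left_mono) linarith+
        moreover have "v y \<le> u y / a" using uv[of y] y a by (simp add: field_simps)
        moreover have "f y = v y - u y / a - u y * (\<epsilon> * u y - 1 / a)"
          by (simp add: f_def power2_eq_square algebra_simps)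
        moreover have "f x \<le> f y" using y by simp
        ultimately show False
          using *(2) by linarith
      qed
      moreover have "0 \<le> a * (norm (horizontal_part y))\<^sup>2" "0 \<le> c - y \<bullet> e_last"
        using a below[of y] y by auto
      ultimately have "a * (norm (horizontal_part y))\<^sup>2 \<le> s" "c - y \<bullet> e_last \<le> s"
        unfolding u_def by - linarith+
      then show "(norm (horizontal_part y))\<^sup>2 \<le> s / a" "\<bar>y \<bullet> e_last\<bar> \<le> \<bar>c\<bar> + s"
        using below[of y] y a by (auto simp: field_simps)
    qed
    have lessC: "f y < f x" if "y \<in> C \<inter> UNIV" for y
    proof -
      have "0 \<le> \<epsilon> * (u y)\<^sup>2" using \<epsilon> by simp
      then show ?thesis using m[of y] that large unfolding f_def by auto
    qed
    have xU: "x \<in> M \<inter> UNIV" using x by simp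
    have lessF: "f y < f x" if "y \<in> M \<inter> UNIV - interior UNIV" for y
      using that by simp
    obtain y \<nu> where "y \<in> M \<inter> UNIV" and \<nu>: "norm \<nu> = 1" and neg: "drift_laplacian \<nu> (g y) (h y) \<le> 0"
      by (rule weak_translator_maximum_principle[OF M closed_UNIV xU bdd lessC lessF f_deriv g_deriv])
    then have y: "y \<in> M" "norm \<nu> = 1" by auto
    define \<tau> where "\<tau> = \<nu> \<bullet> horizontal_part \<nu>"
    have \<tau>: "0 \<le> \<tau>" "\<tau> \<le> 1" using horizontal_part_unit_bounds[OF y(2)] by (auto simp: \<tau>_def)
    have norm_gu: "(norm (gu y))\<^sup>2 = 1 + 4 * a\<^sup>2 * (norm (horizontal_part y))\<^sup>2"
      unfolding norm_horizontal_part gu_def power2_norm_eq_inner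
      by (simp add: inner_diff_left inner_diff_right inner_horizontal_part power2_eq_square)
    have "(\<Sum>b\<in>Basis. b \<bullet> h y b) = 2 * (\<Sum>b\<in>(Basis :: 'n ambient set). b \<bullet> horizontal_part b)
        - 2 * \<epsilon> * (\<Sum>b\<in>Basis. b \<bullet> ((b \<bullet> gu y) *\<^sub>R gu y)) - 4 * \<epsilon> * a * u y * (\<Sum>b\<in>(Basis :: 'n ambient set). b \<bullet> horizontal_part b)"
      by (simp add: h_def inner_diff_right sum_subtractf sum_distrib_left mult.assoc)
    then have trace: "(\<Sum>b\<in>Basis. b \<bullet> h y b) = 2 * n - 2 * \<epsilon> * (norm (gu y))\<^sup>2 - 4 * \<epsilon> * a * u y * n"
      unfolding trace_rank_one trace_horizontal_part n_def by simp
    have eq: "drift_laplacian \<nu> (g y) (h y) = 2 * (n - \<tau>) - 1 - 2 * \<epsilon> * (norm (gu y))\<^sup>2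
        + 2 * \<epsilon> * (\<nu> \<bullet> gu y)\<^sup>2 + 2 * \<epsilon> * u y - 4 * \<epsilon> * a * u y * (n - \<tau>)"
      unfolding drift_laplacian_def trace
      by (simp add: g_def h_def \<tau>_def inner_diff_right inner_diff_left gu_def[of y]
          inner_horizontal_part(3) power2_eq_square algebra_simps)
    have "4 * a\<^sup>2 * (norm (horizontal_part y))\<^sup>2 \<le> u y / 8"
      using mult_mono[of "4 * a" "1 / 8" "a * (norm (horizontal_part y))\<^sup>2" "u y"] uv[OF y(1)] a
      by (simp add: power2_eq_square)
    then have 1: "2 * \<epsilon> * (norm (gu y))\<^sup>2 \<le> 2 * \<epsilon> * (1 + u y / 8)"
      unfolding norm_gu using \<epsilon> by simp
    have "a * (n - \<tau>) \<le> 1 / 16"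
      using a \<tau> by (simp add: algebra_simps)
    then have 2: "4 * \<epsilon> * u y * (a * (n - \<tau>)) \<le> 4 * \<epsilon> * u y * (1 / 16)"
      using \<epsilon> uv[OF y(1)] by (intro mult_left_mono) auto
    have "0 \<le> \<epsilon> * u y" "0 \<le> 2 * \<epsilon> * (\<nu> \<bullet> gu y)\<^sup>2" using \<epsilon> uv[OF y(1)] by auto
    with 1 2 \<epsilon> n \<tau> neg show False
      unfolding eq by (simp add: algebra_simps)
  qed
  have bound: "v x \<le> m" if "x \<in> M" for x
  proof (rule tendsto_upperbound)
    have "((\<lambda>\<epsilon>. v x - \<epsilon> * (u x)\<^sup>2) \<longlongrightarrow> v x - 0 * (u x)\<^sup>2) (at_right 0)"
      by (intro tendsto_intros)
    then show "((\<lambda>\<epsilon>. v x - \<epsilon> * (u x)\<^sup>2) \<longlongrightarrow> v x) (at_right 0)" by simp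
    show "\<forall>\<^sub>F \<epsilon> in at_right 0. v x - \<epsilon> * (u x)\<^sup>2 \<le> m"
      using penalised[OF that] by (auto simp: eventually_at_right_field intro!: exI[of _ "1/2"])
  qed auto
  show ?thesis
  proof (rule bounded_cylinder)
    fix x assume "x \<in> M"
    then show "(norm (horizontal_part x))\<^sup>2 \<le> m" "\<bar>x \<bullet> e_last\<bar> \<le> \<bar>c\<bar> + \<bar>m\<bar>"
      using bound[of x] below[of x] zero_le_power2[of "norm (horizontal_part x)"] unfolding v_def by - linarith+
  qed
qed

section \<open>Ends of properly immersed translators\<close>

lemma smooth_atlas_chart:
  assumes "smooth_atlas X \<A>" and "x \<in> topspace X"
  obtains V \<psi> y where "(V, \<psi>) \<in> \<A>" "y \<in> V" "\<psi> y = x" "open V" "openin X (\<psi> ` V)"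
    "homeomorphic_map (top_of_set V) (subtopology X (\<psi> ` V)) \<psi>"
proof -
  have "x \<in> (\<Union>(V, \<psi>)\<in>\<A>. \<psi> ` V)" and charts: "\<forall>(V, \<psi>)\<in>\<A>. parametrization X V \<psi>"
    using assms by (simp_all add: smooth_atlas_def)
  then obtain V \<psi> y where V: "(V, \<psi>) \<in> \<A>" "y \<in> V" "\<psi> y = x"
    by blast
  then have "parametrization X V \<psi>"
    using charts by blast
  then show thesis
    using that[OF V] by (simp add: parametrization_def embedding_map_def)
qed

lemma times_differentiable_on_subset:
  "times_differentiable_on k f V \<Longrightarrow> W \<subseteq> V \<Longrightarrow> times_differentiable_on k f W"
  by (induction k arbitrary: f) (auto intro: continuous_on_subset)

text \<open>
  A manifold is locally connected. Small coordinate balls are both the connected neighbourhoods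
  that identify components of \<open>X - K\<close> and the domains for the second derivative test.
\<close>

lemma chart_ball_avoiding_closed_set:
  assumes X: "smooth_atlas X \<A>" and K: "closedin X K" and x: "x \<in> topspace X - K"
  obtains V \<psi> y d where "(V, \<psi>) \<in> \<A>" "y \<in> V" "\<psi> y = x" "d > 0" "ball y d \<subseteq> V"
    "openin X (\<psi> ` ball y d)" "connectedin X (\<psi> ` ball y d)" "\<psi> ` ball y d \<inter> K = {}"
proof -
  have "x \<in> topspace X" using x by simp
  then obtain V \<psi> y where V: "(V, \<psi>) \<in> \<A>" "y \<in> V" "\<psi> y = x"
    and par: "open V" "openin X (\<psi> ` V)" "homeomorphic_map (top_of_set V) (subtopology X (\<psi> ` V)) \<psi>"
    by (rule smooth_atlas_chart[OF X])
  have cont: "continuous_map (top_of_set V) X \<psi>"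
    using par(3) by (meson continuous_map_in_subtopology homeomorphic_imp_continuous_map)
  have "openin (top_of_set V) {z \<in> V. \<psi> z \<in> topspace X - K}"
    using openin_continuous_map_preimage[OF cont, of "topspace X - K"] K by auto
  then have "open {z \<in> V. \<psi> z \<in> topspace X - K}"
    using \<open>open V\<close> by (simp add: openin_open_eq)
  moreover have "y \<in> {z \<in> V. \<psi> z \<in> topspace X - K}"
    using V x by auto
  ultimately obtain d where d: "d > 0" "ball y d \<subseteq> {z \<in> V. \<psi> z \<in> topspace X - K}"
    by (meson openE)
  then have sub: "ball y d \<subseteq> V" by auto
  have "openin (top_of_set V) (ball y d)"
    using sub \<open>open V\<close> by (simp add: openin_open_eq)
  then have "openin (subtopology X (\<psi> ` V)) (\<psi> ` ball y d)"
    using homeomorphic_imp_open_map[OF par(3)] by (simp add: open_map_def)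
  then have op: "openin X (\<psi> ` ball y d)"
    using par(2) by (rule openin_trans_full)
  have "connectedin (top_of_set V) (ball y d)"
    using sub by (simp add: connectedin_subtopology)
  then have conn: "connectedin X (\<psi> ` ball y d)"
    by (rule connectedin_continuous_map_image[OF cont])
  have "\<psi> ` ball y d \<inter> K = {}"
    using d(2) by auto
  with op conn show thesis
    by (rule that[OF V d(1) sub])
qed

lemma smooth_immersion_continuous_map:
  fixes F :: "'a \<Rightarrow> 'n::finite ambient"
  assumes X: "smooth_atlas X \<A>" and F: "smooth_immersion \<A> F"
  shows "continuous_map X euclidean F"
proof -
  have "openin X {x \<in> topspace X. F x \<in> U}" if "open U" for U
  proof (subst openin_subopen, intro ballI)
    fix x assume x: "x \<in> {x \<in> topspace X. F x \<in> U}"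
    then have "x \<in> topspace X" by simp
    then obtain V \<psi> y where V: "(V, \<psi>) \<in> \<A>" "y \<in> V" "\<psi> y = x"
      and par: "open V" "openin X (\<psi> ` V)" "homeomorphic_map (top_of_set V) (subtopology X (\<psi> ` V)) \<psi>"
      by (rule smooth_atlas_chart[OF X])
    have "times_differentiable_on 0 (F \<circ> \<psi>) V"
      using F V(1) unfolding smooth_immersion_def smooth_on_def by blast
    then have "open (V \<inter> (F \<circ> \<psi>) -` U)"
      using \<open>open V\<close> that by (simp add: continuous_open_preimage)
    then have "openin (top_of_set V) (V \<inter> (F \<circ> \<psi>) -` U)"
      using \<open>open V\<close> by (simp add: openin_open_eq)
    then have "openin (subtopology X (\<psi> ` V)) (\<psi> ` (V \<inter> (F \<circ> \<psi>) -` U))"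
      using homeomorphic_imp_open_map[OF par(3)] by (simp add: open_map_def)
    then have op: "openin X (\<psi> ` (V \<inter> (F \<circ> \<psi>) -` U))"
      using par(2) by (rule openin_trans_full)
    show "\<exists>T. openin X T \<and> x \<in> T \<and> T \<subseteq> {x \<in> topspace X. F x \<in> U}"
    proof (intro exI conjI)
      show "openin X (\<psi> ` (V \<inter> (F \<circ> \<psi>) -` U))" by (fact op)
      show "x \<in> \<psi> ` (V \<inter> (F \<circ> \<psi>) -` U)" using V x by auto
      show "\<psi> ` (V \<inter> (F \<circ> \<psi>) -` U) \<subseteq> {x \<in> topspace X. F x \<in> U}"
        using openin_subset[OF op] by auto
    qed
  qed
  then show ?thesis
    by (simp add: continuous_map_def)
qed

lemma component_neighbourhood:
  assumes E: "E \<in> connected_components_of (subtopology X (topspace X - K))"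
    and N: "connectedin X N" "N \<inter> K = {}" "N \<inter> E \<noteq> {}"
  shows "N \<subseteq> E"
proof (rule connected_components_of_maximal[OF E])
  show "connectedin (subtopology X (topspace X - K)) N"
    using N connectedin_subset_topspace by (auto simp: connectedin_subtopology)
  show "\<not> disjnt E N"
    using N(3) by (auto simp: disjnt_def)
qed

text \<open>
  A component of the open set \<open>X - K\<close> is relatively closed in it, so its boundary lies in \<open>K\<close>.
\<close>

lemma closure_of_component_subset:
  assumes X: "smooth_atlas X \<A>" and K: "closedin X K"
    and E: "E \<in> connected_components_of (subtopology X (topspace X - K))"
  shows "X closure_of E \<subseteq> E \<union> K"
proof
  fix x assume x: "x \<in> X closure_of E"
  show "x \<in> E \<union> K"
  proof (cases "x \<in> K")
    case False
    then have "x \<in> topspace X - K"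
      using x by (simp add: in_closure_of)
    then obtain V \<psi> y d where "(V, \<psi>) \<in> \<A>" "y \<in> V" and N: "\<psi> y = x" "d > 0" and "ball y d \<subseteq> V"
      and N': "openin X (\<psi> ` ball y d)"
        "connectedin X (\<psi> ` ball y d)" "\<psi> ` ball y d \<inter> K = {}"
      by (rule chart_ball_avoiding_closed_set[OF X K])
    have "x \<in> \<psi> ` ball y d"
      using N(1,2) by force
    moreover from this have "\<psi> ` ball y d \<inter> E \<noteq> {}"
      using x N'(1) unfolding in_closure_of by blast
    ultimately show ?thesis
      using component_neighbourhood[OF E N'(2,3)] by blast
  qed simp
qed

lemma weak_translator_image_of_component:
  fixes F :: "'a \<Rightarrow> 'n::finite ambient"
  assumes F: "self_translating_hypersurface X \<A> F" and K: "closedin X K"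
    and E: "E \<in> connected_components_of (subtopology X (topspace X - K))"
  shows "weak_translator (F ` E)"
  unfolding weak_translator_def
proof (intro allI impI)
  fix f :: "'n ambient \<Rightarrow> real" and g h :: "'n ambient \<Rightarrow> 'n ambient" and U p
  assume "open U" and p: "p \<in> F ` E \<inter> U" and max: "\<forall>z\<in>F ` E \<inter> U. f z \<le> f p"
    and f: "\<forall>z. (f has_derivative (\<lambda>k. g z \<bullet> k)) (at z)" and g: "(g has_derivative h) (at p)"
  have atlas: "smooth_atlas X \<A>" and imm: "smooth_immersion \<A> F"
    using F by (auto simp: self_translating_hypersurface_def smooth_manifold_def)
  obtain x where x: "x \<in> E" "p = F x"
    using p by auto
  have "E \<subseteq> topspace X - K"
    using connected_components_of_subset[OF E] by auto
  with x have "x \<in> topspace X - K" by auto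
  then obtain V \<psi> y d where N: "(V, \<psi>) \<in> \<A>" "y \<in> V" "\<psi> y = x" "d > 0" "ball y d \<subseteq> V"
      and "openin X (\<psi> ` ball y d)" and N': "connectedin X (\<psi> ` ball y d)" "\<psi> ` ball y d \<inter> K = {}"
    by (rule chart_ball_avoiding_closed_set[OF atlas K])
  have ball: "\<psi> ` ball y d \<subseteq> E"
    using component_neighbourhood[OF E N'] N(3,4) x(1) by force
  define \<phi> where "\<phi> = F \<circ> \<psi>"
  have smooth: "times_differentiable_on k \<phi> V" for k
    using imm N(1) unfolding smooth_immersion_def smooth_on_def \<phi>_def by blast
  have "times_differentiable_on 0 \<phi> V" by (rule smooth)
  then have "continuous_on (ball y d) \<phi>"
    using N(5) continuous_on_subset by auto
  define W where "W = ball y d \<inter> \<phi> -` U"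
  have W: "open W"
    using \<open>continuous_on (ball y d) \<phi>\<close> \<open>open U\<close> by (simp add: W_def continuous_open_preimage)
  have yW: "y \<in> W"
    using N(3,4) p x by (simp add: W_def \<phi>_def)
  have "W \<subseteq> V"
    using N(5) by (auto simp: W_def)
  then have smoothW: "times_differentiable_on (Suc (Suc 0)) \<phi> W"
    by (rule times_differentiable_on_subset[OF smooth])
  have inj: "inj (frechet_derivative \<phi> (at y))"
    using imm N(1,2) unfolding smooth_immersion_def \<phi>_def by blast
  have translator: "mean_curvature_vector \<phi> y = (e_last \<bullet> \<nu>) *\<^sub>R \<nu>" if "unit_normal \<phi> y \<nu>" for \<nu>
    using F N(1,2) that unfolding self_translating_hypersurface_def \<phi>_def by blast
  have \<phi>y: "\<phi> y = p"
    using N(3) x(2) by (simp add: \<phi>_def)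
  have maxW: "f (\<phi> z) \<le> f (\<phi> y)" if "z \<in> W" for z
  proof -
    have "\<psi> z \<in> E" using ball that by (auto simp: W_def)
    then show ?thesis using max that unfolding \<phi>y by (simp add: W_def \<phi>_def)
  qed
  obtain \<nu> where "norm \<nu> = 1" "drift_laplacian \<nu> (g (\<phi> y)) h \<le> 0"
    by (rule drift_laplacian_nonpos_at_local_max[where f = f and g = g and h = h, OF W yW smoothW inj translator maxW])
      (use f g \<phi>y in auto)
  then show "\<exists>\<nu>. norm \<nu> = 1 \<and> drift_laplacian \<nu> (g p) h \<le> 0"
    unfolding \<phi>y by blast
qed

theorem corollary6:
  fixes X :: "'a topology"
    and \<A> :: "((real^'n) set \<times> (real^'n \<Rightarrow> 'a)) set"
    and F :: "'a \<Rightarrow> 'n ambient"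
    and E :: "'a set"
    and b\<^sub>1 w\<^sub>1 b\<^sub>2 w\<^sub>2 :: "'n ambient"
  assumes "self_translating_hypersurface X \<A> F"
    and "proper_map X euclidean F"
    and "end_of X E"
    and "norm w\<^sub>1 = 1" and "norm w\<^sub>2 = 1"
    and vertical: "orthogonal w\<^sub>1 e_last" "orthogonal w\<^sub>2 e_last"
    and transverse: "w\<^sub>1 \<noteq> w\<^sub>2" "w\<^sub>1 \<noteq> - w\<^sub>2"
  shows "\<not> F ` E \<subseteq> halfspace b\<^sub>1 w\<^sub>1 \<inter> halfspace b\<^sub>2 w\<^sub>2"
proof
  assume wedge: "F ` E \<subseteq> halfspace b\<^sub>1 w\<^sub>1 \<inter> halfspace b\<^sub>2 w\<^sub>2"
  have w: "norm w\<^sub>1 = 1" "norm w\<^sub>2 = 1" "w\<^sub>1 \<bullet> e_last = 0" "w\<^sub>2 \<bullet> e_last = 0"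
    using assms(4,5) vertical by (simp_all add: orthogonal_def)
  have Hausdorff: "Hausdorff_space X" and atlas: "smooth_atlas X \<A>" and imm: "smooth_immersion \<A> F"
    using assms(1) by (auto simp: self_translating_hypersurface_def smooth_manifold_def)
  obtain K where K: "compactin X K" and E: "E \<in> connected_components_of (subtopology X (topspace X - K))"
    and noncompact: "\<not> compactin X (X closure_of E)"
    using assms(3) by (auto simp: end_of_def)
  have closedK: "closedin X K"
    using Hausdorff K by (rule compactin_imp_closedin)
  have E_sub: "E \<subseteq> topspace X"
    using connected_components_of_subset[OF E] by auto
  have M: "weak_translator (F ` E)"
    using assms(1) closedK E by (rule weak_translator_image_of_component)
  have "compactin euclidean (F ` K)"
    using K smooth_immersion_continuous_map[OF atlas imm] by (rule image_compactin)
  then have C: "compact (F ` K)"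
    by simp
  \<comment> \<open>A proper map is closed, and \<open>E\<close> together with \<open>K\<close> is closed.\<close>
  have "X closure_of E \<union> K = E \<union> K"
    using closure_of_component_subset[OF atlas closedK E] closure_of_subset[OF E_sub] by auto
  moreover have "closedin X (X closure_of E \<union> K)"
    using closedK by (simp add: closedin_Un)
  ultimately have "closedin euclidean (F ` (E \<union> K))"
    using assms(2) by (simp add: proper_map_def closed_map_def)
  then have closed: "closed (F ` E \<union> F ` K)"
    by (simp add: image_Un)
  obtain c where c: "\<And>x. x \<in> F ` K \<Longrightarrow> x \<bullet> e_last < c"
  proof -
    have "bounded ((\<lambda>x. x \<bullet> e_last) ` F ` K)"
      using C by (intro compact_imp_bounded compact_continuous_image continuous_intros)
    then obtain m where m: "\<And>x. x \<in> F ` K \<Longrightarrow> \<bar>x \<bullet> e_last\<bar> \<le> m"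
      unfolding bounded_iff image_image[of _ F] by (metis imageE image_eqI real_norm_def)
    show thesis
      using that[of "m + 1"] m by (meson abs_le_D1 le_less_trans less_add_one)
  qed
  have indep: "\<bar>w\<^sub>1 \<bullet> w\<^sub>2\<bar> < 1"
    using Cauchy_Schwarz_ineq2[of w\<^sub>1 w\<^sub>2] norm_cauchy_schwarz_abs_eq[of w\<^sub>1 w\<^sub>2] w transverse
    by (auto simp: less_le)
  have "bounded (F ` E)"
    using weak_translator_bounded[OF M closed C two_dimensional_if_transverse[OF w transverse]]
      wedge_height_bounded[OF M closed c w indep wedge] by blast
  then obtain r where "\<forall>x\<in>F ` E. norm x \<le> r"
    unfolding bounded_iff by blast
  then have "E \<subseteq> {x \<in> topspace X. F x \<in> cball 0 r}" (is "_ \<subseteq> ?S")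
    using E_sub by auto
  moreover have S: "compactin X ?S"
    using assms(2) by (rule compactin_proper_map_preimage) simp
  moreover from this have "closedin X ?S"
    by (rule compactin_imp_closedin[OF Hausdorff])
  ultimately have "X closure_of E \<subseteq> ?S"
    by (simp add: closure_of_minimal)
  then have "compactin X (X closure_of E)"
    using S closed_compactin closedin_closure_of by blast
  with noncompact show False ..
qed

end
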